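(* Let $X=(X_v)_{v\in V}$ be the binary random vector of a discrete determinantal point process on a finite set $V$ with kernel $K$, and let $A$, $B$, $C$ be non-empty pairwise disjoint subsets of $V$. Then $\big((K_{A\cup B\cup C})^{-1}\big)_{A,B}=0$ if and only if $X_A$ and $X_B$ are conditionally independent in the context $X_C=1_C$, i.e. $$P(X_A=x_A,X_B=x_B\mid X_C=1_C)=P(X_A=x_A\mid X_C=1_C)\,P(X_B=x_B\mid X_C=1_C)$$ for all $x_A\in\{0,1\}^A$ and $x_B\in\{0,1\}^B$.
   Context: Let $V$ be a finite set. A (discrete) determinantal point process (DPP) on $V$ with kernel $K$ is a random subset $Y$ of $V$ such that $\mathbb{P}(A\subseteq Y)=\det(K_A)$ for all non-empty $A\subseteq V$, where $K\in\mathbb{R}^{V\times V}$ is a (symmetric) positive definite matrix with all eigenvalues at most $1$, and $K_A$ is the principal submatrix of $K$ with rows and columns indexed by $A$. Equivalently, the DPP is the binary random vector $X=(X_v)_{v\in V}\in\{0,1\}^V$ with $X_v=1$ iff $v\in Y$, so that $P(X_A=1_A)=\det(K_A)$, where $X_A=(X_v)_{v\in A}$ and $1_A$ is the all-ones vector indexed by $A$. For a matrix $M$, $M_{A,B}$ denotes the submatrix with rows indexed by $A$ and columns indexed by $B$; thus $\big((K_{A\cup B\cup C})^{-1}\big)_{A,B}$ is the $A\times B$ block of the inverse of $K_{A\cup B\cup C}$. *)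

theory Defs
  imports "HOL-Analysis.Analysis" "HOL-Probability.Probability"
begin

definition eigenvalue :: "real ^ 'v ^ 'v \<Rightarrow> real \<Rightarrow> bool" where
  "eigenvalue K l \<longleftrightarrow> (\<exists>x. x \<noteq> 0 \<and> K *v x = l *\<^sub>R x)"

definition positive_definite :: "real ^ 'v ^ 'v \<Rightarrow> bool" where
  "positive_definite K \<longleftrightarrow> transpose K = K \<and> (\<forall>x. x \<noteq> 0 \<longrightarrow> x \<bullet> (K *v x) > 0)"

(* The determinant of the principal submatrix of K with rows and columns indexed by S. The index
   set is a set rather than a type, so this is the Leibniz formula that also defines det, with
   permutations of S in place of permutations of the whole index type; see principal_det_UNIV. *)
definition principal_det :: "real ^ 'v ^ 'v \<Rightarrow> 'v set \<Rightarrow> real" where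
  "principal_det K S = (\<Sum>p | p permutes S. of_int (sign p) * (\<Prod>i\<in>S. K $ i $ p i))"

(* The two-sided inverse of the principal submatrix of K indexed by S. Only the entries with both
   indices in S are meaningful, the others are arbitrary; as for matrix_inv, the value is arbitrary
   if the submatrix is singular. See principal_inv_UNIV. *)
definition principal_inv :: "real ^ 'v ^ 'v \<Rightarrow> 'v set \<Rightarrow> real ^ 'v ^ 'v" where
  "principal_inv K S = (SOME N. \<forall>i\<in>S. \<forall>j\<in>S.
     (\<Sum>k\<in>S. K $ i $ k * N $ k $ j) = (if i = j then 1 else 0) \<and>
     (\<Sum>k\<in>S. N $ i $ k * K $ k $ j) = (if i = j then 1 else 0))"

lemma principal_det_UNIV: "principal_det K UNIV = det K"
  by (simp add: principal_det_def det_def)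

lemma principal_inv_UNIV: "principal_inv K UNIV = matrix_inv K"
  unfolding principal_inv_def matrix_inv_def
  by (rule arg_cong[where f = Eps])
    (auto simp: fun_eq_iff vec_eq_iff matrix_matrix_mult_def mat_def)

(* The ground set is the finite type of indices of K. *)
definition dpp :: "'w measure \<Rightarrow> real ^ 'v ^ 'v \<Rightarrow> ('w \<Rightarrow> 'v set) \<Rightarrow> bool" where
  "dpp M K Y \<longleftrightarrow>
     prob_space M \<and> Y \<in> M \<rightarrow>\<^sub>M count_space UNIV \<and>
     positive_definite K \<and> (\<forall>l. eigenvalue K l \<longrightarrow> l \<le> 1) \<and>
     (\<forall>A. A \<noteq> {} \<longrightarrow> \<P>(\<omega> in M. A \<subseteq> Y \<omega>) = principal_det K A)"

definition binary_vector :: "('w \<Rightarrow> 'v set) \<Rightarrow> 'w \<Rightarrow> 'v \<Rightarrow> nat" where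
  "binary_vector Y \<omega> v = (if v \<in> Y \<omega> then 1 else 0)"

end

theory Submission
  imports Defs
begin

text \<open>
  Let L be the Schur complement of the block of K indexed by C. Given that C is contained in Y, the
  set D is contained in Y with probability det (K restricted to C and D) / det (K restricted to C),
  which is det (L restricted to D); so conditionally Y is again determinantal, with kernel L. On the
  union of A and B, the inverse of L is the block of the inverse of K restricted to A, B and C.
  Hence the A-B block of the latter vanishes iff that of L does. If it does, the minors of L
  factorise over A and B, and the inclusion events, being stable under intersection, determine
  independence; conversely, independence for the singletons of i in A and j in B says that the
  square of the entry of L at (i, j) is 0.
\<close>

section \<open>Principal submatrices\<close>

text \<open>
  Since dimensions are types, a principal submatrix is extended to the whole index type by the
  identity, which preserves its determinant and its inverse.
\<close>

definition pad :: "real ^ 'v ^ 'v \<Rightarrow> 'v set \<Rightarrow> real ^ 'v ^ 'v" where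
  "pad K S = (\<chi> i j. if i \<in> S \<and> j \<in> S then K $ i $ j else if i = j then 1 else 0)"

text \<open>Only the right-inverse equation is imposed, and only for indices in S; entries of N
  outside S stay free. The left-inverse equation is recovered by
  \<open>inverse_on_commute\<close>.\<close>

definition inverse_on :: "'v set \<Rightarrow> real ^ 'v ^ 'v \<Rightarrow> real ^ 'v ^ 'v \<Rightarrow> bool" where
  "inverse_on S K N \<longleftrightarrow>
     (\<forall>i\<in>S. \<forall>j\<in>S. (\<Sum>k\<in>S. K $ i $ k * N $ k $ j) = (if i = j then 1 else 0))"

lemma sum_if_mem:
  fixes f :: "'v::finite \<Rightarrow> real"
  shows "(\<Sum>k\<in>UNIV. if k \<in> S then f k else 0) = sum f S"
  by (simp add: sum.If_cases)

lemma sum_mult_delta: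
  fixes f :: "'v::finite \<Rightarrow> real"
  shows "(\<Sum>k\<in>S. f k * (if k = j then 1 else 0)) = (if j \<in> S then f j else 0)"
proof -
  have "(\<Sum>k\<in>S. f k * (if k = j then 1 else 0)) = (\<Sum>k\<in>S. if k = j then f k else 0)"
    by (intro sum.cong) auto
  then show ?thesis by simp
qed

text \<open>Up to the order of the indices, a padded matrix is block diagonal with an S-block and an
  identity block, and such matrices multiply blockwise.\<close>

lemma pad_mult:
  fixes K N :: "real ^ 'v::finite ^ 'v"
  shows "pad K S ** pad N S = pad (\<chi> i j. \<Sum>k\<in>S. K $ i $ k * N $ k $ j) S"
proof -
  have "(\<Sum>k\<in>UNIV. pad K S $ i $ k * pad N S $ k $ j)
      = pad (\<chi> i j. \<Sum>k\<in>S. K $ i $ k * N $ k $ j) S $ i $ j" for i j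
  proof (cases "i \<in> S")
    case True
    have "(\<Sum>k\<in>UNIV. pad K S $ i $ k * pad N S $ k $ j)
        = (\<Sum>k\<in>UNIV. if k \<in> S then K $ i $ k * pad N S $ k $ j else 0)"
      using True by (intro sum.cong) (auto simp: pad_def)
    also have "\<dots> = (\<Sum>k\<in>S. K $ i $ k * pad N S $ k $ j)"
      by (rule sum_if_mem)
    also have "\<dots> = pad (\<chi> i j. \<Sum>k\<in>S. K $ i $ k * N $ k $ j) S $ i $ j"
      using True by (auto simp: pad_def intro!: sum.neutral)
    finally show ?thesis .
  next
    case False
    have "(\<Sum>k\<in>UNIV. pad K S $ i $ k * pad N S $ k $ j)
        = (\<Sum>k\<in>UNIV. if k \<in> {i} then pad N S $ i $ j else 0)"
      using False by (intro sum.cong) (auto simp: pad_def)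
    also have "\<dots> = pad (\<chi> i j. \<Sum>k\<in>S. K $ i $ k * N $ k $ j) S $ i $ j"
      unfolding sum_if_mem using False by (simp add: pad_def)
    finally show ?thesis .
  qed
  then show ?thesis
    by (simp add: matrix_matrix_mult_def vec_eq_iff)
qed

section \<open>Inverses on an index set\<close>

lemma inverse_on_iff_pad:
  fixes K N :: "real ^ 'v::finite ^ 'v"
  shows "inverse_on S K N \<longleftrightarrow> pad K S ** pad N S = mat 1"
  unfolding pad_mult by (auto simp: inverse_on_def pad_def mat_def vec_eq_iff)

text \<open>A one-sided inverse of a square matrix is two-sided; padding carries this fact from the
  full index type to S.\<close>

lemma inverse_on_commute:
  fixes K N :: "real ^ 'v::finite ^ 'v"
  shows "inverse_on S K N \<longleftrightarrow> inverse_on S N K"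
  unfolding inverse_on_iff_pad by (rule matrix_left_right_inverse)

lemma inverse_on_transpose:
  fixes K N :: "real ^ 'v::finite ^ 'v"
  shows "inverse_on S (transpose N) (transpose K) \<longleftrightarrow> inverse_on S K N"
  by (auto simp: inverse_on_def transpose_def mult.commute)

lemma inverse_on_unique:
  fixes K N :: "real ^ 'v::finite ^ 'v"
  assumes "inverse_on S K N" "inverse_on S K N'" "i \<in> S" "j \<in> S"
  shows "N $ i $ j = N' $ i $ j"
proof -
  have "pad N' S ** pad K S = mat 1"
    using assms(2) inverse_on_commute inverse_on_iff_pad by blast
  then have "pad N S = pad N' S"
    using assms(1) unfolding inverse_on_iff_pad
    by (metis matrix_mul_assoc matrix_mul_lid matrix_mul_rid)
  then have "pad N S $ i $ j = pad N' S $ i $ j" by simp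
  then show ?thesis using assms by (simp add: pad_def)
qed

text \<open>Since N_AB = 0, the B-columns of L N = 1 involve only the rows of N in B. They read L_AB
  N_BB = 0 and L_BB N_BB = 1, so L_AB = L_AB (N_BB L_BB) = (L_AB N_BB) L_BB = 0.\<close>

lemma inverse_on_block:
  fixes L N :: "real ^ 'v::finite ^ 'v"
  assumes LN: "inverse_on (A \<union> B) L N" and disj: "A \<inter> B = {}"
    and N0: "\<And>i j. i \<in> A \<Longrightarrow> j \<in> B \<Longrightarrow> N $ i $ j = 0"
    and i: "i \<in> A" and j: "j \<in> B"
  shows "L $ i $ j = 0"
proof -
  have B: "(\<Sum>k\<in>B. L $ i $ k * N $ k $ j) = (if i = j then 1 else 0)"
    if "i \<in> A \<union> B" "j \<in> B" for i j
  proof -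
    have "(\<Sum>k\<in>A \<union> B. L $ i $ k * N $ k $ j)
        = (\<Sum>k\<in>A. L $ i $ k * N $ k $ j) + (\<Sum>k\<in>B. L $ i $ k * N $ k $ j)"
      using disj by (intro sum.union_disjoint) auto
    moreover have "(\<Sum>k\<in>A. L $ i $ k * N $ k $ j) = 0"
      using that N0 by simp
    ultimately show ?thesis
      using LN that by (auto simp: inverse_on_def)
  qed
  then have "inverse_on B L N" by (simp add: inverse_on_def)
  then have NL: "inverse_on B N L" by (simp only: inverse_on_commute)
  have "L $ i $ j = (\<Sum>k\<in>B. L $ i $ k * (if k = j then 1 else 0))"
    using j by (simp only: sum_mult_delta if_True)
  also have "\<dots> = (\<Sum>k\<in>B. L $ i $ k * (\<Sum>l\<in>B. N $ k $ l * L $ l $ j))"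
    using NL j by (intro sum.cong) (auto simp: inverse_on_def)
  also have "\<dots> = (\<Sum>k\<in>B. \<Sum>l\<in>B. L $ i $ k * N $ k $ l * L $ l $ j)"
    by (simp add: sum_distrib_left mult.assoc)
  also have "\<dots> = (\<Sum>l\<in>B. \<Sum>k\<in>B. L $ i $ k * N $ k $ l * L $ l $ j)"
    by (rule sum.swap)
  also have "\<dots> = (\<Sum>l\<in>B. (\<Sum>k\<in>B. L $ i $ k * N $ k $ l) * L $ l $ j)"
    by (simp add: sum_distrib_right)
  also have "\<dots> = (\<Sum>l\<in>B. 0)"
    using B i disj by (intro sum.cong) auto
  finally show ?thesis by simp
qed

text \<open>A permutation contributing to the Leibniz formula must fix every index of a unit row.\<close>

lemma det_unit_rows:
  fixes M :: "real ^ 'v::finite ^ 'v"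
  assumes unit: "\<And>i j. i \<notin> S \<Longrightarrow> M $ i $ j = (if i = j then 1 else 0)"
  shows "det M = principal_det M S"
proof -
  have "det M = (\<Sum>p | p permutes UNIV. of_int (sign p) * (\<Prod>i\<in>UNIV. M $ i $ p i))"
    by (simp add: det_def)
  also have "\<dots> = (\<Sum>p | p permutes S. of_int (sign p) * (\<Prod>i\<in>UNIV. M $ i $ p i))"
  proof (rule sum.mono_neutral_right)
    show "finite {p :: 'v \<Rightarrow> 'v. p permutes UNIV}" by simp
    show "{p. p permutes S} \<subseteq> {p. p permutes UNIV}"
      by (auto intro: permutes_subset)
    show "\<forall>p\<in>{p. p permutes UNIV} - {p. p permutes S}.
        of_int (sign p) * (\<Prod>i\<in>UNIV. M $ i $ p i) = 0"
    proof
      fix p :: "'v \<Rightarrow> 'v"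
      assume p: "p \<in> {p. p permutes UNIV} - {p. p permutes S}"
      then obtain i where "i \<notin> S" "p i \<noteq> i"
        by (auto simp: permutes_def)
      then have "M $ i $ p i = 0" using unit by auto
      then have "(\<Prod>i\<in>UNIV. M $ i $ p i) = 0" by auto
      then show "of_int (sign p) * (\<Prod>i\<in>UNIV. M $ i $ p i) = 0" by simp
    qed
  qed
  also have "\<dots> = principal_det M S"
    unfolding principal_det_def
  proof (rule sum.cong)
    fix p assume "p \<in> {p. p permutes S}"
    then have "(\<Prod>i\<in>S. M $ i $ p i) = (\<Prod>i\<in>UNIV. M $ i $ p i)"
      using unit by (intro prod.mono_neutral_left) (auto simp: permutes_def)
    then show "of_int (sign p) * (\<Prod>i\<in>UNIV. M $ i $ p i)
        = of_int (sign p) * (\<Prod>i\<in>S. M $ i $ p i)" by simp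
  qed simp
  finally show ?thesis .
qed

section \<open>Principal minors and invertibility\<close>

lemma principal_det_cong:
  assumes "\<And>i j. i \<in> S \<Longrightarrow> j \<in> S \<Longrightarrow> M $ i $ j = N $ i $ j"
  shows "principal_det M S = principal_det N S"
  unfolding principal_det_def
  by (intro sum.cong arg_cong2[where f = "(*)"] prod.cong refl)
    (auto simp: assms permutes_in_image)

lemma det_pad:
  fixes K :: "real ^ 'v::finite ^ 'v"
  shows "det (pad K S) = principal_det K S"
proof -
  have "det (pad K S) = principal_det (pad K S) S"
    by (rule det_unit_rows) (simp add: pad_def)
  also have "\<dots> = principal_det K S"
    by (rule principal_det_cong) (simp add: pad_def)
  finally show ?thesis .
qed

lemma principal_det_empty: "principal_det K {} = 1"
  by (simp add: principal_det_def)

lemma principal_det_singleton: "principal_det K {i} = K $ i $ i"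
  by (simp add: principal_det_def)

lemma principal_det_pair:
  assumes "i \<noteq> j"
  shows "principal_det K {i, j} = K $ i $ i * K $ j $ j - K $ i $ j * K $ j $ i"
proof -
  have "{p. p permutes {i, j}} = {id, Transposition.transpose i j}"
    by (auto simp: permutes_doubleton_iff)
  moreover have "Transposition.transpose i j \<noteq> id"
    using assms by (metis id_apply transpose_apply_first)
  ultimately show ?thesis
    using assms by (simp add: principal_det_def sign_swap_id)
qed

text \<open>The padded matrix factors as \<open>pad L D ** V\<close>, where V has the rows of L in E
  and unit rows elsewhere; \<open>det_unit_rows\<close> evaluates both factors. The E-D block may be
  nonzero, as it is in general for the matrix R of \<open>principal_det_schur\<close>.\<close>

lemma principal_det_block_triangular:
  fixes L :: "real ^ 'v::finite ^ 'v"
  assumes disj: "D \<inter> E = {}"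
    and L0: "\<And>i j. i \<in> D \<Longrightarrow> j \<in> E \<Longrightarrow> L $ i $ j = 0"
  shows "principal_det L (D \<union> E) = principal_det L D * principal_det L E"
proof -
  define V :: "real ^ 'v ^ 'v" where
    "V = (\<chi> i j. if i \<in> E \<and> j \<in> D \<union> E then L $ i $ j else if i = j then 1 else 0)"
  have "(\<Sum>k\<in>UNIV. pad L D $ i $ k * V $ k $ j) = pad L (D \<union> E) $ i $ j" for i j
  proof (cases "i \<in> D")
    case True
    have "(\<Sum>k\<in>UNIV. pad L D $ i $ k * V $ k $ j)
        = (\<Sum>k\<in>UNIV. if k \<in> D then L $ i $ k * (if k = j then 1 else 0) else 0)"
      using True disj by (intro sum.cong) (auto simp: pad_def V_def)
    also have "\<dots> = (if j \<in> D then L $ i $ j else 0)"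
      unfolding sum_if_mem sum_mult_delta ..
    also have "\<dots> = pad L (D \<union> E) $ i $ j"
      using True disj L0 by (auto simp: pad_def)
    finally show ?thesis .
  next
    case False
    have "(\<Sum>k\<in>UNIV. pad L D $ i $ k * V $ k $ j) = (\<Sum>k\<in>UNIV. if k \<in> {i} then V $ i $ j else 0)"
      using False by (intro sum.cong) (auto simp: pad_def)
    also have "\<dots> = pad L (D \<union> E) $ i $ j"
      unfolding sum_if_mem using False by (auto simp: pad_def V_def)
    finally show ?thesis .
  qed
  then have "pad L D ** V = pad L (D \<union> E)"
    by (simp add: matrix_matrix_mult_def vec_eq_iff)
  then have "principal_det L (D \<union> E) = det (pad L D) * det V"
    by (metis det_pad det_mul)
  also have "det V = principal_det V E"
    by (rule det_unit_rows) (simp add: V_def)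
  also have "\<dots> = principal_det L E"
    by (rule principal_det_cong) (simp add: V_def)
  finally show ?thesis by (simp add: det_pad)
qed

text \<open>The unit rows force a kernel vector x to vanish outside S. On S the padded matrix acts
  on such an x as K does, so the quadratic form of K vanishes at x and positive definiteness gives x
  = 0.\<close>

lemma invertible_pad:
  fixes K :: "real ^ 'v::finite ^ 'v"
  assumes "positive_definite K"
  shows "invertible (pad K S)"
proof -
  have "x = 0" if x: "pad K S *v x = 0" for x
  proof -
    have out: "x $ i = 0" if "i \<notin> S" for i
    proof -
      have "(pad K S *v x) $ i = (\<Sum>k\<in>UNIV. x $ k * (if k = i then 1 else 0))"
        unfolding matrix_vector_mult_def vec_lambda_beta using that
        by (intro sum.cong) (auto simp: pad_def)
      also have "\<dots> = x $ i"
        by (simp only: sum_mult_delta UNIV_I if_True)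
      finally show ?thesis using x by simp
    qed
    have "x $ i * (K *v x) $ i = 0" for i
    proof (cases "i \<in> S")
      case True
      have "(K *v x) $ i = (pad K S *v x) $ i"
        unfolding matrix_vector_mult_def vec_lambda_beta using True out
        by (intro sum.cong) (auto simp: pad_def)
      then show ?thesis using x by simp
    qed (simp add: out)
    then have "x \<bullet> (K *v x) = 0" by (auto simp: inner_vec_def intro!: sum.neutral)
    then show "x = 0" using assms unfolding positive_definite_def by force
  qed
  then show ?thesis
    by (metis matrix_left_invertible_ker invertible_left_inverse)
qed

text \<open>The inverse of the padded matrix is a witness for the choice in
  \<open>principal_inv\<close>, whose value is therefore a genuine inverse on S.\<close>

lemma inverse_on_principal_inv:
  fixes K :: "real ^ 'v::finite ^ 'v"
  assumes "positive_definite K"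
  shows "inverse_on S K (principal_inv K S)"
proof -
  obtain Q where Q: "pad K S ** Q = mat 1" "Q ** pad K S = mat 1"
    using invertible_pad[OF assms] unfolding invertible_def by blast
  have "inverse_on S K Q"
    unfolding inverse_on_def
  proof (intro ballI)
    fix i j assume ij: "i \<in> S" "j \<in> S"
    have "(\<Sum>k\<in>S. K $ i $ k * Q $ k $ j) = (\<Sum>k\<in>UNIV. pad K S $ i $ k * Q $ k $ j)"
      using ij by (intro sum.mono_neutral_cong_left) (auto simp: pad_def)
    also have "\<dots> = (pad K S ** Q) $ i $ j"
      by (simp add: matrix_matrix_mult_def)
    finally show "(\<Sum>k\<in>S. K $ i $ k * Q $ k $ j) = (if i = j then 1 else 0)"
      by (simp add: Q mat_def)
  qed
  moreover from this have "inverse_on S Q K" by (simp only: inverse_on_commute)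
  ultimately have "\<exists>N. \<forall>i\<in>S. \<forall>j\<in>S.
     (\<Sum>k\<in>S. K $ i $ k * N $ k $ j) = (if i = j then 1 else 0) \<and>
     (\<Sum>k\<in>S. N $ i $ k * K $ k $ j) = (if i = j then 1 else 0)"
    unfolding inverse_on_def by blast
  from someI_ex[OF this] show ?thesis
    unfolding inverse_on_def principal_inv_def by blast
qed

lemma principal_det_nonzero:
  fixes K :: "real ^ 'v::finite ^ 'v"
  assumes "positive_definite K"
  shows "principal_det K S \<noteq> 0"
  using invertible_pad[OF assms] by (simp add: det_pad invertible_det_nz)

section \<open>Schur complements\<close>

text \<open>This is K - K_{*,C} (K_C)^{-1} K_{C,*}, taken over all index pairs. Outside C it is the
  usual Schur complement; keeping the columns in C, which are zero by \<open>schur_eq_0\<close>,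
  lets sums be extended over C.\<close>

definition schur :: "real ^ 'v ^ 'v \<Rightarrow> 'v set \<Rightarrow> real ^ 'v ^ 'v" where
  "schur K C = (\<chi> i j. K $ i $ j -
     (\<Sum>k\<in>C. (\<Sum>l\<in>C. K $ i $ l * principal_inv K C $ l $ k) * K $ k $ j))"

text \<open>Transposing the inverse of the symmetric block K_C gives another inverse of it, so by
  uniqueness that inverse is symmetric on C, and the correction term of the Schur complement
  inherits the symmetry.\<close>

lemma schur_sym:
  fixes K :: "real ^ 'v::finite ^ 'v"
  assumes "positive_definite K"
  shows "schur K C $ i $ j = schur K C $ j $ i"
proof -
  let ?H = "principal_inv K C"
  have K: "transpose K = K" using assms by (simp add: positive_definite_def)
  then have Kij: "K $ i $ j = K $ j $ i" for i j
    by (metis transpose_def vec_lambda_beta)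
  have inv: "inverse_on C K ?H" using assms by (rule inverse_on_principal_inv)
  then have "inverse_on C K (transpose ?H)"
    using inverse_on_transpose[of C ?H K] K inverse_on_commute by metis
  then have H: "?H $ k $ l = ?H $ l $ k" if "k \<in> C" "l \<in> C" for k l
    using inverse_on_unique[OF inv _ that] by (simp add: transpose_def)
  have "(\<Sum>k\<in>C. (\<Sum>l\<in>C. K $ i $ l * ?H $ l $ k) * K $ k $ j)
      = (\<Sum>k\<in>C. \<Sum>l\<in>C. K $ i $ l * ?H $ l $ k * K $ k $ j)"
    by (simp add: sum_distrib_right)
  also have "\<dots> = (\<Sum>l\<in>C. \<Sum>k\<in>C. K $ i $ l * ?H $ l $ k * K $ k $ j)"
    by (rule sum.swap)
  also have "\<dots> = (\<Sum>l\<in>C. \<Sum>k\<in>C. K $ j $ k * ?H $ k $ l * K $ l $ i)"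
    using H Kij by (intro sum.cong refl) (simp add: mult.commute mult.left_commute)
  also have "\<dots> = (\<Sum>k\<in>C. (\<Sum>l\<in>C. K $ j $ l * ?H $ l $ k) * K $ k $ i)"
    by (simp add: sum_distrib_right)
  finally show ?thesis using Kij[of i j] by (simp add: schur_def)
qed

text \<open>After reassociation, the inverse of K_C meets column j of K_C and leaves the unit vector
  at j.\<close>

lemma principal_inv_cancel:
  fixes K :: "real ^ 'v::finite ^ 'v"
  assumes "positive_definite K" and j: "j \<in> C"
  shows "(\<Sum>k\<in>C. (\<Sum>l\<in>C. K $ i $ l * principal_inv K C $ l $ k) * K $ k $ j) = K $ i $ j"
proof -
  let ?H = "principal_inv K C"
  have HK: "inverse_on C ?H K"
    using inverse_on_principal_inv[OF assms(1)] inverse_on_commute by blast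
  have "(\<Sum>k\<in>C. (\<Sum>l\<in>C. K $ i $ l * ?H $ l $ k) * K $ k $ j)
      = (\<Sum>k\<in>C. \<Sum>l\<in>C. K $ i $ l * (?H $ l $ k * K $ k $ j))"
    by (simp add: sum_distrib_right mult.assoc)
  also have "\<dots> = (\<Sum>l\<in>C. \<Sum>k\<in>C. K $ i $ l * (?H $ l $ k * K $ k $ j))"
    by (rule sum.swap)
  also have "\<dots> = (\<Sum>l\<in>C. K $ i $ l * (\<Sum>k\<in>C. ?H $ l $ k * K $ k $ j))"
    by (simp add: sum_distrib_left)
  also have "\<dots> = (\<Sum>l\<in>C. K $ i $ l * (if l = j then 1 else 0))"
    using HK j by (intro sum.cong) (auto simp: inverse_on_def)
  also have "\<dots> = K $ i $ j" using j by (simp only: sum_mult_delta if_True)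
  finally show ?thesis .
qed

lemma schur_eq_0:
  fixes K :: "real ^ 'v::finite ^ 'v"
  assumes "positive_definite K" "j \<in> C"
  shows "schur K C $ i $ j = 0"
  using principal_inv_cancel[OF assms] by (simp add: schur_def)

text \<open>Block Gaussian elimination: on C \<union> D, K = U R, where U is unit triangular with
  the multipliers F = K_DC (K_C)^{-1}, and R keeps the rows of K in C but has those of the Schur
  complement in D. The determinant of U is 1, and R is block triangular.\<close>

lemma principal_det_schur:
  fixes K :: "real ^ 'v::finite ^ 'v"
  assumes pd: "positive_definite K" and disj: "C \<inter> D = {}"
  shows "principal_det K (C \<union> D) = principal_det K C * principal_det (schur K C) D"
proof -
  define F :: "'v \<Rightarrow> 'v \<Rightarrow> real"
    where "F i k = (\<Sum>l\<in>C. K $ i $ l * principal_inv K C $ l $ k)" for i k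
  define U :: "real ^ 'v ^ 'v" where
    "U = (\<chi> i j. if i \<in> D \<and> j \<in> C then F i j else if i = j then 1 else 0)"
  define R :: "real ^ 'v ^ 'v" where
    "R = (\<chi> i j. if i \<in> C then K $ i $ j else schur K C $ i $ j)"
  have "(\<Sum>k\<in>UNIV. U $ i $ k * pad R (C \<union> D) $ k $ j) = pad K (C \<union> D) $ i $ j" for i j
  proof (cases "i \<in> D")
    case True
    have "(\<Sum>k\<in>UNIV. U $ i $ k * pad R (C \<union> D) $ k $ j)
        = (\<Sum>k\<in>UNIV. (if k \<in> C then F i k * pad R (C \<union> D) $ k $ j else 0)
            + (if k \<in> {i} then pad R (C \<union> D) $ i $ j else 0))"
      using True disj by (intro sum.cong) (auto simp: U_def)
    also have "\<dots> = (\<Sum>k\<in>C. F i k * pad R (C \<union> D) $ k $ j) + pad R (C \<union> D) $ i $ j"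
      unfolding sum.distrib sum_if_mem by simp
    also have "\<dots> = pad K (C \<union> D) $ i $ j"
    proof (cases "j \<in> C \<union> D")
      case jm: True
      then have "(\<Sum>k\<in>C. F i k * pad R (C \<union> D) $ k $ j) = (\<Sum>k\<in>C. F i k * K $ k $ j)"
        by (intro sum.cong) (auto simp: pad_def R_def)
      moreover have "pad R (C \<union> D) $ i $ j = K $ i $ j - (\<Sum>k\<in>C. F i k * K $ k $ j)"
        using True jm disj by (auto simp: pad_def R_def schur_def F_def)
      ultimately show ?thesis using True jm by (simp add: pad_def)
    next
      case False
      then have "(\<Sum>k\<in>C. F i k * pad R (C \<union> D) $ k $ j) = 0"
        by (intro sum.neutral) (auto simp: pad_def)
      then show ?thesis using False by (simp add: pad_def)
    qed
    finally show ?thesis .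
  next
    case False
    have "(\<Sum>k\<in>UNIV. U $ i $ k * pad R (C \<union> D) $ k $ j)
        = (\<Sum>k\<in>UNIV. if k \<in> {i} then pad R (C \<union> D) $ i $ j else 0)"
      using False by (intro sum.cong) (auto simp: U_def)
    also have "\<dots> = pad K (C \<union> D) $ i $ j"
      unfolding sum_if_mem using False by (auto simp: pad_def R_def)
    finally show ?thesis .
  qed
  then have "U ** pad R (C \<union> D) = pad K (C \<union> D)"
    by (simp add: matrix_matrix_mult_def vec_eq_iff)
  then have "principal_det K (C \<union> D) = det U * principal_det R (C \<union> D)"
    by (metis det_pad det_mul)
  also have "det U = principal_det U D"
    by (rule det_unit_rows) (simp add: U_def)
  also have "\<dots> = principal_det (mat 1) D"
    using disj by (intro principal_det_cong) (auto simp: U_def mat_def)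
  also have "\<dots> = 1"
  proof -
    have "pad (mat 1 :: real ^ 'v ^ 'v) D = mat 1"
      by (auto simp: pad_def mat_def vec_eq_iff)
    then show ?thesis by (metis det_pad det_I)
  qed
  \<comment> \<open>D goes first because the D-C block of R vanishes, whereas its C-D block is that
    of K.\<close>
  also have "principal_det R (C \<union> D) = principal_det R D * principal_det R C"
    unfolding Un_commute[of C D]
    using disj schur_eq_0[OF pd] by (intro principal_det_block_triangular) (auto simp: R_def)
  also have "principal_det R D = principal_det (schur K C) D"
    using disj by (intro principal_det_cong) (auto simp: R_def)
  also have "principal_det R C = principal_det K C"
    by (intro principal_det_cong) (auto simp: R_def)
  finally show ?thesis by simp
qed

text \<open>The zero columns of the Schur complement allow the sum over T to run over T \<union> C.
  There its row i is row i of K minus a combination of the rows of K in C; multiplied by column j of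
  N, the latter rows give 0, since j lies in T and hence not in C.\<close>

lemma inverse_on_schur:
  fixes K :: "real ^ 'v::finite ^ 'v"
  assumes pd: "positive_definite K" and disj: "T \<inter> C = {}"
    and inv: "inverse_on (T \<union> C) K N"
  shows "inverse_on T (schur K C) N"
  unfolding inverse_on_def
proof (intro ballI)
  fix i j assume i: "i \<in> T" and j: "j \<in> T"
  define F where "F k = (\<Sum>l\<in>C. K $ i $ l * principal_inv K C $ l $ k)" for k
  have "(\<Sum>k\<in>T. schur K C $ i $ k * N $ k $ j) = (\<Sum>k\<in>T \<union> C. schur K C $ i $ k * N $ k $ j)"
    using schur_eq_0[OF pd] disj by (intro sum.mono_neutral_left) auto
  also have "\<dots> = (\<Sum>k\<in>T \<union> C. K $ i $ k * N $ k $ j)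
      - (\<Sum>k\<in>T \<union> C. \<Sum>c\<in>C. F c * (K $ c $ k * N $ k $ j))"
    by (simp add: schur_def F_def left_diff_distrib sum_subtractf sum_distrib_right mult.assoc)
  also have "(\<Sum>k\<in>T \<union> C. \<Sum>c\<in>C. F c * (K $ c $ k * N $ k $ j))
      = (\<Sum>c\<in>C. F c * (\<Sum>k\<in>T \<union> C. K $ c $ k * N $ k $ j))"
    unfolding sum_distrib_left by (rule sum.swap)
  also have "\<dots> = (\<Sum>c\<in>C. 0)"
    using inv j disj by (intro sum.cong) (auto simp: inverse_on_def)
  finally show "(\<Sum>k\<in>T. schur K C $ i $ k * N $ k $ j) = (if i = j then 1 else 0)"
    using inv i j by (simp add: inverse_on_def)
qed

text \<open>On A \<union> B the two matrices are inverse to each other, so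
  \<open>inverse_on_block\<close> applies in both directions with their roles exchanged.\<close>

lemma principal_inv_block_iff_schur_block:
  fixes K :: "real ^ 'v::finite ^ 'v"
  assumes pd: "positive_definite K"
    and disj: "A \<inter> B = {}" "A \<inter> C = {}" "B \<inter> C = {}"
  shows "(\<forall>i\<in>A. \<forall>j\<in>B. principal_inv K (A \<union> B \<union> C) $ i $ j = 0) \<longleftrightarrow>
    (\<forall>i\<in>A. \<forall>j\<in>B. schur K C $ i $ j = 0)"
proof -
  have LN: "inverse_on (A \<union> B) (schur K C) (principal_inv K (A \<union> B \<union> C))"
    using disj by (intro inverse_on_schur inverse_on_principal_inv pd) auto
  then have NL: "inverse_on (A \<union> B) (principal_inv K (A \<union> B \<union> C)) (schur K C)"
    by (simp only: inverse_on_commute)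
  show ?thesis
    using inverse_on_block[OF LN disj(1)] inverse_on_block[OF NL disj(1)] by blast
qed

text \<open>The quotients are the form in which the conditional inclusion probabilities arise;
  \<open>principal_det_schur\<close> turns each into a minor of the Schur complement.\<close>

lemma schur_block_iff_principal_det:
  fixes K :: "real ^ 'v::finite ^ 'v"
  assumes pd: "positive_definite K"
    and disj: "A \<inter> B = {}" "A \<inter> C = {}" "B \<inter> C = {}"
  shows "(\<forall>i\<in>A. \<forall>j\<in>B. schur K C $ i $ j = 0) \<longleftrightarrow>
    (\<forall>D E. D \<subseteq> A \<longrightarrow> E \<subseteq> B \<longrightarrow>
       principal_det K (C \<union> (D \<union> E)) / principal_det K C =
       principal_det K (C \<union> D) / principal_det K C * (principal_det K (C \<union> E) / principal_det K C))"
proof -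
  let ?L = "schur K C"
  have quot: "principal_det K (C \<union> D) / principal_det K C = principal_det ?L D"
    if "D \<subseteq> A \<union> B" for D
    using that disj principal_det_schur[OF pd, of C D] principal_det_nonzero[OF pd, of C]
    by (auto simp: field_simps)
  have "(\<forall>i\<in>A. \<forall>j\<in>B. ?L $ i $ j = 0) \<longleftrightarrow>
    (\<forall>D E. D \<subseteq> A \<longrightarrow> E \<subseteq> B \<longrightarrow>
       principal_det ?L (D \<union> E) = principal_det ?L D * principal_det ?L E)" (is "?l \<longleftrightarrow> ?r")
  proof
    assume ?l
    then show ?r
      using disj by (intro allI impI principal_det_block_triangular) blast+
  next
    assume r: ?r
    show ?l
    proof (intro ballI)
      fix i j assume ij: "i \<in> A" "j \<in> B"
      then have ne: "i \<noteq> j" using disj by auto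
      \<comment> \<open>The 2 by 2 minor is L_ii L_jj - L_ij L_ji, so factorisation leaves L_ij L_ji
        = 0, and symmetry makes this a square.\<close>
      have "principal_det ?L {i, j} = principal_det ?L {i} * principal_det ?L {j}"
        using r[rule_format, of "{i}" "{j}"] ij by (simp add: insert_commute)
      then have "?L $ i $ j * ?L $ j $ i = 0"
        using principal_det_pair[OF ne, of ?L] by (simp add: principal_det_singleton)
      then show "?L $ i $ j = 0"
        using schur_sym[OF pd, of C i j] by simp
    qed
  qed
  also have "\<dots> \<longleftrightarrow> (\<forall>D E. D \<subseteq> A \<longrightarrow> E \<subseteq> B \<longrightarrow>
       principal_det K (C \<union> (D \<union> E)) / principal_det K C =
       principal_det K (C \<union> D) / principal_det K C * (principal_det K (C \<union> E) / principal_det K C))"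
    using quot by (intro iff_allI imp_cong refl) (simp add: le_supI1 le_supI2 Un_mono)
  finally show ?thesis .
qed

section \<open>Independence of the traces of a random set\<close>

definition hit_events :: "'w set \<Rightarrow> ('w \<Rightarrow> 'v set) \<Rightarrow> 'v set \<Rightarrow> 'w set set" where
  "hit_events W Y A = (\<lambda>D. {\<omega>\<in>W. D \<subseteq> Y \<omega>}) ` Pow A"

text \<open>Events for distinct D are disjoint; the empty event is inserted so that the family is
  closed under intersection.\<close>

definition trace_events :: "'w set \<Rightarrow> ('w \<Rightarrow> 'v set) \<Rightarrow> 'v set \<Rightarrow> 'w set set" where
  "trace_events W Y A = insert {} ((\<lambda>D. {\<omega>\<in>W. Y \<omega> \<inter> A = D}) ` Pow A)"

lemma Int_stable_hit_events: "Int_stable (hit_events W Y A)"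
proof (rule Int_stableI)
  fix P Q assume "P \<in> hit_events W Y A" "Q \<in> hit_events W Y A"
  then obtain D E where "D \<subseteq> A" "E \<subseteq> A" "P = {\<omega>\<in>W. D \<subseteq> Y \<omega>}" "Q = {\<omega>\<in>W. E \<subseteq> Y \<omega>}"
    unfolding hit_events_def by blast
  then have "P \<inter> Q = {\<omega>\<in>W. D \<union> E \<subseteq> Y \<omega>}" "D \<union> E \<subseteq> A" by auto
  then show "P \<inter> Q \<in> hit_events W Y A" unfolding hit_events_def by blast
qed

lemma Int_stable_trace_events: "Int_stable (trace_events W Y A)"
proof (rule Int_stableI)
  fix P Q assume "P \<in> trace_events W Y A" "Q \<in> trace_events W Y A"
  moreover from this have "P = Q \<or> P \<inter> Q = {}" unfolding trace_events_def by blast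
  ultimately show "P \<inter> Q \<in> trace_events W Y A" by (auto simp: trace_events_def)
qed

text \<open>Y contains D iff its trace on A is one of the finitely many sets between D and
  A.\<close>

lemma hit_events_subset_sigma_trace:
  fixes Y :: "'w \<Rightarrow> 'v::finite set"
  shows "hit_events W Y A \<subseteq> sigma_sets W (trace_events W Y A)"
proof
  fix P assume "P \<in> hit_events W Y A"
  then obtain D where D: "D \<subseteq> A" "P = {\<omega>\<in>W. D \<subseteq> Y \<omega>}"
    unfolding hit_events_def by blast
  then have "P = (\<Union>D'\<in>{D'. D \<subseteq> D' \<and> D' \<subseteq> A}. {\<omega>\<in>W. Y \<omega> \<inter> A = D'})" by auto
  moreover have "(\<Union>D'\<in>{D'. D \<subseteq> D' \<and> D' \<subseteq> A}. {\<omega>\<in>W. Y \<omega> \<inter> A = D'})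
      \<in> sigma_sets W (trace_events W Y A)"
    by (intro sigma_sets_UNION) (auto simp: trace_events_def countable_finite)
  ultimately show "P \<in> sigma_sets W (trace_events W Y A)" by simp
qed

text \<open>The trace on A is D iff Y contains D and contains no singleton from A - D.\<close>

lemma trace_events_subset_sigma_hit:
  fixes Y :: "'w \<Rightarrow> 'v::finite set"
  shows "trace_events W Y A \<subseteq> sigma_sets W (hit_events W Y A)"
proof
  fix P assume "P \<in> trace_events W Y A"
  then consider "P = {}" | D where "D \<subseteq> A" "P = {\<omega>\<in>W. Y \<omega> \<inter> A = D}"
    unfolding trace_events_def by blast
  then show "P \<in> sigma_sets W (hit_events W Y A)"
  proof cases
    case (2 D)
    interpret sigma_algebra W "sigma_sets W (hit_events W Y A)"
      by (rule sigma_algebra_sigma_sets) (auto simp: hit_events_def)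
    have "P = {\<omega>\<in>W. D \<subseteq> Y \<omega>} - (\<Union>v\<in>A - D. {\<omega>\<in>W. {v} \<subseteq> Y \<omega>})"
      using 2 by auto
    moreover have hit: "{\<omega>\<in>W. E \<subseteq> Y \<omega>} \<in> sigma_sets W (hit_events W Y A)" if "E \<subseteq> A" for E
      using that by (intro sigma_sets.Basic) (auto simp: hit_events_def)
    have "{\<omega>\<in>W. D \<subseteq> Y \<omega>} - (\<Union>v\<in>A - D. {\<omega>\<in>W. {v} \<subseteq> Y \<omega>})
        \<in> sigma_sets W (hit_events W Y A)"
      using 2 by (intro Diff finite_UN hit) auto
    ultimately show ?thesis by simp
  qed (simp add: sigma_sets.Empty)
qed

text \<open>Both families are closed under intersection and each lies in the sigma-algebra generated
  by the other. Independence extends from such a family to its sigma-algebra, hence passes between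
  the two.\<close>

lemma (in prob_space) indep_hit_iff_indep_trace:
  fixes Y :: "'a \<Rightarrow> 'v::finite set"
  assumes Y: "Y \<in> M \<rightarrow>\<^sub>M count_space UNIV"
  shows "(\<forall>D E. D \<subseteq> A \<longrightarrow> E \<subseteq> B \<longrightarrow>
      \<P>(\<omega> in M. D \<union> E \<subseteq> Y \<omega>) = \<P>(\<omega> in M. D \<subseteq> Y \<omega>) * \<P>(\<omega> in M. E \<subseteq> Y \<omega>)) \<longleftrightarrow>
    (\<forall>D E. D \<subseteq> A \<longrightarrow> E \<subseteq> B \<longrightarrow>
      \<P>(\<omega> in M. Y \<omega> \<inter> A = D \<and> Y \<omega> \<inter> B = E) =
      \<P>(\<omega> in M. Y \<omega> \<inter> A = D) * \<P>(\<omega> in M. Y \<omega> \<inter> B = E))" (is "?hit \<longleftrightarrow> ?trace")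
proof -
  let ?W = "space M"
  have ev: "{\<omega>\<in>?W. P (Y \<omega>)} \<in> events" for P
    using Y by measurable
  have sub: "hit_events ?W Y U \<subseteq> events" "trace_events ?W Y U \<subseteq> events" for U
    by (auto simp: hit_events_def trace_events_def intro: ev)
  have hit: "?hit \<longleftrightarrow> indep_set (hit_events ?W Y A) (hit_events ?W Y B)"
  proof -
    have "{\<omega>\<in>?W. D \<union> E \<subseteq> Y \<omega>} = {\<omega>\<in>?W. D \<subseteq> Y \<omega>} \<inter> {\<omega>\<in>?W. E \<subseteq> Y \<omega>}" for D E
      by auto
    then show ?thesis
      using sub[of A] sub[of B] unfolding indep_sets2_eq by (auto simp: hit_events_def)
  qed
  \<comment> \<open>The inserted empty event contributes only product equations of the form 0 =
    0.\<close>
  have trace: "?trace \<longleftrightarrow> indep_set (trace_events ?W Y A) (trace_events ?W Y B)"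
  proof -
    have "{\<omega>\<in>?W. Y \<omega> \<inter> A = D \<and> Y \<omega> \<inter> B = E}
        = {\<omega>\<in>?W. Y \<omega> \<inter> A = D} \<inter> {\<omega>\<in>?W. Y \<omega> \<inter> B = E}" for D E
      by auto
    then show ?thesis
      using sub[of A] sub[of B] unfolding indep_sets2_eq by (auto simp: trace_events_def)
  qed
  have "indep_set G H" if "indep_set G' H'" "Int_stable G'" "Int_stable H'"
    "G \<subseteq> sigma_sets ?W G'" "H \<subseteq> sigma_sets ?W H'" for G H G' H'
  proof -
    have "indep_set (sigma_sets ?W G') (sigma_sets ?W H')"
      using that by (intro indep_set_sigma_sets)
    then show ?thesis
      using that(4,5) unfolding indep_sets2_eq by blast
  qed
  then have "indep_set (hit_events ?W Y A) (hit_events ?W Y B) \<longleftrightarrow>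
      indep_set (trace_events ?W Y A) (trace_events ?W Y B)"
    by (meson Int_stable_hit_events Int_stable_trace_events
        hit_events_subset_sigma_trace trace_events_subset_sigma_hit)
  then show ?thesis using hit trace by simp
qed

section \<open>Conditioning\<close>

text \<open>Conditioning becomes a change of measure, so that results on independence in a
  probability space apply to the conditional law.\<close>

lemma prob_uniform_measure_eq_cond_prob:
  assumes "prob_space M" "{\<omega>\<in>space M. P \<omega>} \<in> sets M" "{\<omega>\<in>space M. Q \<omega>} \<in> sets M"
    "\<P>(\<omega> in M. Q \<omega>) \<noteq> 0"
  shows "\<P>(\<omega> in uniform_measure M {\<omega>\<in>space M. Q \<omega>}. P \<omega>) = \<P>(\<omega> in M. P \<omega> \<bar> Q \<omega>)"
proof -
  interpret prob_space M by fact
  have "{\<omega>\<in>space M. Q \<omega>} \<inter> {\<omega>\<in>space M. P \<omega>} = {\<omega>\<in>space M. P \<omega> \<and> Q \<omega>}" by auto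
  then show ?thesis
    using assms by (simp add: cond_prob_def emeasure_eq_measure)
qed

section \<open>Binary vectors as subsets, and the equivalence\<close>

lemma restrict_binary_vector_eq_iff:
  assumes "x \<in> A \<rightarrow>\<^sub>E {0, 1}"
  shows "restrict (binary_vector Y \<omega>) A = x \<longleftrightarrow> Y \<omega> \<inter> A = {v\<in>A. x v = 1}"
proof
  assume "restrict (binary_vector Y \<omega>) A = x"
  then show "Y \<omega> \<inter> A = {v\<in>A. x v = 1}"
    by (auto simp: binary_vector_def restrict_def split: if_splits)
next
  assume Y: "Y \<omega> \<inter> A = {v\<in>A. x v = 1}"
  show "restrict (binary_vector Y \<omega>) A = x"
  proof
    fix v
    show "restrict (binary_vector Y \<omega>) A v = x v"
    proof (cases "v \<in> A")
      case True
      moreover from this have "x v = 0 \<or> x v = 1" using assms by auto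
      moreover from True have "v \<in> Y \<omega> \<longleftrightarrow> x v = 1" using Y by auto
      ultimately show ?thesis by (auto simp: binary_vector_def)
    qed (use assms in \<open>auto simp: PiE_def extensional_def\<close>)
  qed
qed

text \<open>Every subset D of A arises from a binary vector, namely its indicator restricted to
  A.\<close>

lemma ball_PiE_binary_iff:
  "(\<forall>x \<in> A \<rightarrow>\<^sub>E {0, 1::nat}. P {v\<in>A. x v = 1}) \<longleftrightarrow> (\<forall>D. D \<subseteq> A \<longrightarrow> P D)"
proof
  assume l: "\<forall>x \<in> A \<rightarrow>\<^sub>E {0, 1::nat}. P {v\<in>A. x v = 1}"
  show "\<forall>D. D \<subseteq> A \<longrightarrow> P D"
  proof (intro allI impI)
    fix D assume "D \<subseteq> A"
    then have "{v\<in>A. (\<lambda>v\<in>A. if v \<in> D then 1 else 0::nat) v = 1} = D" by auto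
    moreover have "(\<lambda>v\<in>A. if v \<in> D then 1 else 0::nat) \<in> A \<rightarrow>\<^sub>E {0, 1}" by auto
    ultimately show "P D" using l by metis
  qed
qed auto

text \<open>The definition of \<open>dpp\<close> covers non-empty sets; for the empty set both the
  probability and the empty determinant are 1.\<close>

lemma dpp_prob:
  assumes "dpp M K Y"
  shows "\<P>(\<omega> in M. D \<subseteq> Y \<omega>) = principal_det K D"
proof (cases "D = {}")
  case True
  have "prob_space M" using assms by (simp add: dpp_def)
  then show ?thesis using True by (simp add: principal_det_empty prob_space.prob_space)
qed (use assms in \<open>simp add: dpp_def\<close>)

theorem theorem1:
  fixes M :: "'w measure"
    and K :: "real ^ 'v::finite ^ 'v"
    and Y :: "'w \<Rightarrow> 'v set"
    and X :: "'w \<Rightarrow> 'v \<Rightarrow> nat"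
    and A B C :: "'v set"
  assumes "dpp M K Y"
    and "X = binary_vector Y"
    and "A \<noteq> {}" and "B \<noteq> {}" and "C \<noteq> {}"
    and "A \<inter> B = {}" and "A \<inter> C = {}" and "B \<inter> C = {}"
  shows "(\<forall>i\<in>A. \<forall>j\<in>B. principal_inv K (A \<union> B \<union> C) $ i $ j = 0) \<longleftrightarrow>
    (\<forall>xA \<in> A \<rightarrow>\<^sub>E {0, 1}. \<forall>xB \<in> B \<rightarrow>\<^sub>E {0, 1}.
       \<P>(\<omega> in M. restrict (X \<omega>) A = xA \<and> restrict (X \<omega>) B = xB \<bar> restrict (X \<omega>) C = (\<lambda>v\<in>C. 1)) =
       \<P>(\<omega> in M. restrict (X \<omega>) A = xA \<bar> restrict (X \<omega>) C = (\<lambda>v\<in>C. 1)) *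
       \<P>(\<omega> in M. restrict (X \<omega>) B = xB \<bar> restrict (X \<omega>) C = (\<lambda>v\<in>C. 1)))"
proof -
  have prob: "prob_space M" and Y: "Y \<in> M \<rightarrow>\<^sub>M count_space UNIV" and pd: "positive_definite K"
    using assms(1) by (auto simp: dpp_def)
  interpret prob_space M by fact
  let ?Q = "\<lambda>\<omega>. C \<subseteq> Y \<omega>"
  let ?M = "uniform_measure M {\<omega>\<in>space M. ?Q \<omega>}"
  have ev: "{\<omega>\<in>space M. P (Y \<omega>)} \<in> sets M" for P
    using Y by measurable
  \<comment> \<open>The context has nonzero probability by positive definiteness, so the conditional
    probabilities are true quotients and not the default value of division by 0.\<close>
  have Q0: "\<P>(\<omega> in M. ?Q \<omega>) \<noteq> 0"
    using dpp_prob[OF assms(1), of C] principal_det_nonzero[OF pd, of C] by simp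
  have cond: "\<P>(\<omega> in M. P (Y \<omega>) \<bar> ?Q \<omega>) = \<P>(\<omega> in ?M. P (Y \<omega>))" for P
    using prob_uniform_measure_eq_cond_prob[OF prob ev ev Q0] by simp
  interpret U: prob_space ?M
    using Q0 by (intro prob_space_uniform_measure) (auto simp: emeasure_eq_measure)
  have YU: "Y \<in> ?M \<rightarrow>\<^sub>M count_space UNIV"
    using Y by (simp add: measurable_def)
  have hit: "\<P>(\<omega> in ?M. D \<subseteq> Y \<omega>) = principal_det K (C \<union> D) / principal_det K C" for D
  proof -
    have *: "{\<omega>\<in>space M. D \<subseteq> Y \<omega> \<and> C \<subseteq> Y \<omega>} = {\<omega>\<in>space M. C \<union> D \<subseteq> Y \<omega>}" by auto
    show ?thesis
      unfolding cond[of "\<lambda>S. D \<subseteq> S", symmetric] cond_prob_def * dpp_prob[OF assms(1)] ..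
  qed
  have ctx: "restrict (X \<omega>) C = (\<lambda>v\<in>C. 1) \<longleftrightarrow> ?Q \<omega>" for \<omega>
  proof -
    have "restrict (X \<omega>) C = (\<lambda>v\<in>C. 1) \<longleftrightarrow> Y \<omega> \<inter> C = {v\<in>C. (\<lambda>v\<in>C. 1::nat) v = 1}"
      unfolding assms(2) by (rule restrict_binary_vector_eq_iff) auto
    then show ?thesis by auto
  qed
  let ?ind = "\<lambda>D E. \<P>(\<omega> in ?M. Y \<omega> \<inter> A = D \<and> Y \<omega> \<inter> B = E) =
      \<P>(\<omega> in ?M. Y \<omega> \<inter> A = D) * \<P>(\<omega> in ?M. Y \<omega> \<inter> B = E)"
  have "(\<forall>i\<in>A. \<forall>j\<in>B. principal_inv K (A \<union> B \<union> C) $ i $ j = 0) \<longleftrightarrow>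
      (\<forall>D E. D \<subseteq> A \<longrightarrow> E \<subseteq> B \<longrightarrow> \<P>(\<omega> in ?M. D \<union> E \<subseteq> Y \<omega>) =
        \<P>(\<omega> in ?M. D \<subseteq> Y \<omega>) * \<P>(\<omega> in ?M. E \<subseteq> Y \<omega>))"
    unfolding hit
    using principal_inv_block_iff_schur_block[OF pd assms(6-8)]
      schur_block_iff_principal_det[OF pd assms(6-8)] by simp
  also have "\<dots> \<longleftrightarrow> (\<forall>D E. D \<subseteq> A \<longrightarrow> E \<subseteq> B \<longrightarrow> ?ind D E)"
    by (rule U.indep_hit_iff_indep_trace[OF YU])
  \<comment> \<open>The quantifiers are nested so that \<open>ball_PiE_binary_iff\<close> can
    replace first E, then D, by a binary vector.\<close>
  also have "\<dots> \<longleftrightarrow> (\<forall>D. D \<subseteq> A \<longrightarrow> (\<forall>E. E \<subseteq> B \<longrightarrow> ?ind D E))"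
    by blast
  also have "\<dots> \<longleftrightarrow> (\<forall>xA \<in> A \<rightarrow>\<^sub>E {0, 1::nat}. \<forall>xB \<in> B \<rightarrow>\<^sub>E {0, 1::nat}.
      ?ind {v\<in>A. xA v = 1} {v\<in>B. xB v = 1})"
    by (simp only: ball_PiE_binary_iff[where P = "?ind D" for D]
        ball_PiE_binary_iff[where P = "\<lambda>D. \<forall>E. E \<subseteq> B \<longrightarrow> ?ind D E"])
  also have "\<dots> \<longleftrightarrow> (\<forall>xA \<in> A \<rightarrow>\<^sub>E {0, 1}. \<forall>xB \<in> B \<rightarrow>\<^sub>E {0, 1}.
       \<P>(\<omega> in M. restrict (X \<omega>) A = xA \<and> restrict (X \<omega>) B = xB \<bar> restrict (X \<omega>) C = (\<lambda>v\<in>C. 1)) =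
       \<P>(\<omega> in M. restrict (X \<omega>) A = xA \<bar> restrict (X \<omega>) C = (\<lambda>v\<in>C. 1)) *
       \<P>(\<omega> in M. restrict (X \<omega>) B = xB \<bar> restrict (X \<omega>) C = (\<lambda>v\<in>C. 1)))"
  proof (intro ball_cong refl)
    fix xA xB :: "'v \<Rightarrow> nat"
    assume xA: "xA \<in> A \<rightarrow>\<^sub>E {0, 1}" and xB: "xB \<in> B \<rightarrow>\<^sub>E {0, 1}"
    let ?D = "{v\<in>A. xA v = 1}" and ?E = "{v\<in>B. xB v = 1}"
    show "?ind ?D ?E \<longleftrightarrow>
       \<P>(\<omega> in M. restrict (X \<omega>) A = xA \<and> restrict (X \<omega>) B = xB \<bar> restrict (X \<omega>) C = (\<lambda>v\<in>C. 1)) =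
       \<P>(\<omega> in M. restrict (X \<omega>) A = xA \<bar> restrict (X \<omega>) C = (\<lambda>v\<in>C. 1)) *
       \<P>(\<omega> in M. restrict (X \<omega>) B = xB \<bar> restrict (X \<omega>) C = (\<lambda>v\<in>C. 1))"
      unfolding ctx unfolding assms(2)
        restrict_binary_vector_eq_iff[OF xA] restrict_binary_vector_eq_iff[OF xB]
      using cond[of "\<lambda>S. S \<inter> A = ?D \<and> S \<inter> B = ?E"] cond[of "\<lambda>S. S \<inter> A = ?D"]
        cond[of "\<lambda>S. S \<inter> B = ?E"] by simp
  qed
  finally show ?thesis .
qed

end
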